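(* No choice of row signs makes the principal matrix of any of the three exceptional seeds, for $D_4\downarrow G_2$, $E_6\downarrow F_4$ and $F_4\downarrow B_4$, skew-symmetrizable. That is, if $B_0$ is the square integer matrix of exponent differences of the mutable variables in the two monomials of the exchange polynomials, then for every diagonal matrix $D_\varepsilon$ with entries $\pm1$ the matrix $D_\varepsilon B_0$ is not skew-symmetrizable.
   Context: A square integer matrix $C$ is skew-symmetrizable if $DC$ is skew-symmetric for some positive diagonal matrix $D$. For a seed with binomial exchange polynomials $E_i=M_i^++M_i^-$, the principal matrix $B_0$ has entries $b_{ij}=$ (exponent of $x_j$ in $M_i^+$) $-$ (exponent of $x_j$ in $M_i^-$), $i,j$ mutable; exchanging the two monomials changes the sign of row $i$. The seeds are: $D_4\downarrow G_2$: mutable $x_1,\dots,x_4$, frozen $c_1,\dots,c_6$; $E_1=x_4+c_3c_5$, $E_2=c_3c_6x_1+c_2x_4^2$, $E_3=c_1c_6+c_2c_4x_4$, $E_4=c_6x_1+c_5x_2x_3$. $F_4\downarrow B_4$: mutable $x_1,\dots,x_4$, frozen $c_1,\dots,c_8$; $E_1=c_8x_2+c_5x_4$, $E_2=c_3x_1x_3+c_2c_5x_4$, $E_3=c_6x_2+c_2c_4c_5$, $E_4=c_7x_2+c_1c_3c_8$. $E_6\downarrow F_4$: mutable $u_{12},u_4,u_9,u_{21},u_{22},u_{23},u_{24},u_{25}$, frozen $z_1,z_2,z_3,z_5,z_7,z_8,z_{10},z_{13},z_{14},z_{33}$; exchange polynomials (indexed as the mutable variables) $E_{12}=u_4u_{24}+u_9u_{21}$,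 $E_4=u_{21}z_3+u_{12}z_1z_5$, $E_9=u_{12}z_2z_{10}+u_{24}z_{14}$, $E_{21}=u_{12}z_5z_{33}+u_4u_{22}u_{24}$, $E_{22}=u_{21}z_7+u_{23}z_5$, $E_{23}=u_{22}u_{25}z_8+z_7z_{13}z_{33}$, $E_{24}=u_9u_{21}u_{25}+u_{12}z_{10}z_{33}$, $E_{25}=u_{24}z_7+u_{23}z_{10}$. *)

theory Defs
  imports
    "HOL-Library.Poly_Mapping"
    "Jordan_Normal_Form.Matrix"
    Complex_Main
begin

section \<open>Skew-symmetrizable integer matrices\<close>

definition skew_symmetric :: "'a::uminus mat \<Rightarrow> bool" where
  "skew_symmetric A \<longleftrightarrow> square_mat A \<and> transpose_mat A = - A"

definition positive_diagonal :: "nat \<Rightarrow> real mat \<Rightarrow> bool" where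
  "positive_diagonal n D \<longleftrightarrow>
     D \<in> carrier_mat n n \<and> diagonal_mat D \<and> (\<forall>i<n. D $$ (i,i) > 0)"

definition skew_symmetrizable :: "int mat \<Rightarrow> bool" where
  "skew_symmetrizable A \<longleftrightarrow> square_mat A \<and>
     (\<exists>D. positive_diagonal (dim_row A) D \<and> skew_symmetric (D * map_mat real_of_int A))"

definition sign_diagonal :: "nat \<Rightarrow> int mat \<Rightarrow> bool" where
  "sign_diagonal n D \<longleftrightarrow>
     D \<in> carrier_mat n n \<and> diagonal_mat D \<and> (\<forall>i<n. D $$ (i,i) \<in> {1, -1})"


section \<open>Seeds and their principal matrices\<close>

text \<open>Monomials are exponent vectors; integer polynomials are finitely supported
  functions from monomials to coefficients.\<close>

type_synonym 'v monomial = "'v \<Rightarrow>\<^sub>0 nat"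
type_synonym 'v polynomial = "'v monomial \<Rightarrow>\<^sub>0 int"

definition monomial_poly :: "'v monomial \<Rightarrow> 'v polynomial" where
  "monomial_poly m = Poly_Mapping.single m 1"

definition variable :: "'v \<Rightarrow> 'v polynomial" where
  "variable v = monomial_poly (Poly_Mapping.single v 1)"

text \<open>The \<open>i\<close>-th exchange polynomial belongs to the \<open>i\<close>-th mutable variable.\<close>

record 'v seed =
  mutable_vars :: "'v list"
  frozen_vars :: "'v list"
  exchange_polys :: "'v polynomial list"

text \<open>An exchange polynomial does not order its two monomials, so the principal
  matrix is determined only up to the signs of its rows. It is therefore a
  relation between seeds and matrices.\<close>

definition principal_matrix :: "'v seed \<Rightarrow> int mat \<Rightarrow> bool" where
  "principal_matrix S B \<longleftrightarrow>
     (let n = length (mutable_vars S) in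
      B \<in> carrier_mat n n \<and>
      (\<forall>i<n. \<exists>Mp Mm.
         exchange_polys S ! i = monomial_poly Mp + monomial_poly Mm \<and>
         (\<forall>j<n. B $$ (i,j) =
            int (Poly_Mapping.lookup Mp (mutable_vars S ! j)) - int (Poly_Mapping.lookup Mm (mutable_vars S ! j)))))"


section \<open>The three exceptional seeds\<close>

datatype var = XVar nat | CVar nat | UVar nat | ZVar nat

abbreviation X :: "nat \<Rightarrow> var polynomial" where "X i \<equiv> variable (XVar i)"
abbreviation C :: "nat \<Rightarrow> var polynomial" where "C i \<equiv> variable (CVar i)"
abbreviation U :: "nat \<Rightarrow> var polynomial" where "U i \<equiv> variable (UVar i)"
abbreviation Z :: "nat \<Rightarrow> var polynomial" where "Z i \<equiv> variable (ZVar i)"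

definition seed_D4_G2 :: "var seed" where
  "seed_D4_G2 = \<lparr>
     mutable_vars = map XVar [1,2,3,4],
     frozen_vars = map CVar [1,2,3,4,5,6],
     exchange_polys =
      [X 4 + C 3 * C 5,
       C 3 * C 6 * X 1 + C 2 * X 4 ^ 2,
       C 1 * C 6 + C 2 * C 4 * X 4,
       C 6 * X 1 + C 5 * X 2 * X 3]\<rparr>"

definition seed_F4_B4 :: "var seed" where
  "seed_F4_B4 = \<lparr>
     mutable_vars = map XVar [1,2,3,4],
     frozen_vars = map CVar [1,2,3,4,5,6,7,8],
     exchange_polys =
      [C 8 * X 2 + C 5 * X 4,
       C 3 * X 1 * X 3 + C 2 * C 5 * X 4,
       C 6 * X 2 + C 2 * C 4 * C 5,
       C 7 * X 2 + C 1 * C 3 * C 8]\<rparr>"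

definition seed_E6_F4 :: "var seed" where
  "seed_E6_F4 = \<lparr>
     mutable_vars = map UVar [12,4,9,21,22,23,24,25],
     frozen_vars = map ZVar [1,2,3,5,7,8,10,13,14,33],
     exchange_polys =
      [U 4 * U 24 + U 9 * U 21,
       U 21 * Z 3 + U 12 * Z 1 * Z 5,
       U 12 * Z 2 * Z 10 + U 24 * Z 14,
       U 12 * Z 5 * Z 33 + U 4 * U 22 * U 24,
       U 21 * Z 7 + U 23 * Z 5,
       U 22 * U 25 * Z 8 + Z 7 * Z 13 * Z 33,
       U 9 * U 21 * U 25 + U 12 * Z 10 * Z 33,
       U 24 * Z 7 + U 23 * Z 10]\<rparr>"


section \<open>Existence of the principal matrices\<close>

lemma principal_matrix_exists:
  assumes "\<And>i. i < length (mutable_vars S) \<Longrightarrow>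
    \<exists>Mp Mm. exchange_polys S ! i = monomial_poly Mp + monomial_poly Mm"
  shows "\<exists>B. principal_matrix S B"
proof -
  obtain P M where PM: "\<And>i. i < length (mutable_vars S) \<Longrightarrow>
      exchange_polys S ! i = monomial_poly (P i) + monomial_poly (M i)"
    using assms by metis
  define n where "n = length (mutable_vars S)"
  let ?B = "mat n n (\<lambda>(i,j). int (Poly_Mapping.lookup (P i) (mutable_vars S ! j))
                           - int (Poly_Mapping.lookup (M i) (mutable_vars S ! j)))"
  have "principal_matrix S ?B"
    unfolding principal_matrix_def Let_def n_def[symmetric]
    using PM[folded n_def] by fastforce
  then show ?thesis by blast
qed

lemma monomial_poly_mult: "monomial_poly a * monomial_poly b = monomial_poly (a + b)"
  by (simp add: monomial_poly_def mult_single)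

lemma monomial_poly_binomial:
  "\<exists>Mp Mm. monomial_poly a + monomial_poly b = monomial_poly Mp + monomial_poly Mm"
  by blast

lemma exceptional_principal_matrix_exists:
  assumes "S \<in> {seed_D4_G2, seed_E6_F4, seed_F4_B4}"
  shows "\<exists>B. principal_matrix S B"
  by (rule principal_matrix_exists)
    (use assms in \<open>auto simp: seed_D4_G2_def seed_E6_F4_def seed_F4_B4_def variable_def
       monomial_poly_mult power2_eq_square less_Suc_eq monomial_poly_binomial\<close>)

end

theory Submission
  imports Defs
begin

text \<open>
  If \<open>D * A\<close> is skew-symmetric with \<open>D\<close> positive diagonal, then \<open>D\<^sub>i A\<^sub>i\<^sub>j = - D\<^sub>j A\<^sub>j\<^sub>i\<close>, so
  the entries \<open>A\<^sub>i\<^sub>j\<close> and \<open>A\<^sub>j\<^sub>i\<close> have opposite signs and in particular vanish together. Each of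
  the three matrices violates this sign condition, whatever the signs of its rows. The
  magnitudes of the entries play no role.

  For \<open>D\<^sub>4 \<down> G\<^sub>2\<close> and \<open>F\<^sub>4 \<down> B\<^sub>4\<close> the zero pattern is not symmetric: \<open>b\<^sub>2\<^sub>1 \<noteq> 0 = b\<^sub>1\<^sub>2\<close> in the
  former, \<open>b\<^sub>1\<^sub>4 \<noteq> 0 = b\<^sub>4\<^sub>1\<close> in the latter. For \<open>E\<^sub>6 \<down> F\<^sub>4\<close> the zero pattern is symmetric, and
  the obstruction is a cycle. A pair of mutually nonzero entries \<open>b\<^sub>i\<^sub>j\<close>, \<open>b\<^sub>j\<^sub>i\<close> forces the signs
  chosen for the rows \<open>i\<close> and \<open>j\<close> to agree if \<open>b\<^sub>i\<^sub>j\<close> and \<open>b\<^sub>j\<^sub>i\<close> have opposite signs, and to differ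
  if they have the same sign. Take the two monomials of each exchange polynomial in the order
  in which they are written. Along the 5-cycle of variables \<open>u\<^sub>2\<^sub>1, u\<^sub>2\<^sub>2, u\<^sub>2\<^sub>3, u\<^sub>2\<^sub>5, u\<^sub>2\<^sub>4\<close> all
  consecutive pairs demand agreement except the pair \<open>u\<^sub>2\<^sub>5, u\<^sub>2\<^sub>4\<close>, where both entries are
  positive; this is impossible.

  Since the principal matrix is itself defined only up to row signs, it has to be known that an
  exchange polynomial determines its unordered pair of monomials
  (\<open>monomial_poly_add_eq_iff\<close>); the two sources of row signs are then merged into one.
\<close>

section \<open>Signs of the entries of a skew-symmetrizable matrix\<close>

lemma diagonal_mult_entry:
  fixes D A :: "'a::semiring_0 mat"
  assumes "D \<in> carrier_mat n n" "diagonal_mat D" "A \<in> carrier_mat n m" "i < n" "j < m"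
  shows "(D * A) $$ (i,j) = D $$ (i,i) * A $$ (i,j)"
proof -
  have "(D * A) $$ (i,j) = (\<Sum>k<n. D $$ (i,k) * A $$ (k,j))"
    using assms by (simp add: scalar_prod_def lessThan_atLeast0)
  also have "\<dots> = (\<Sum>k<n. if k = i then D $$ (i,i) * A $$ (i,j) else 0)"
    using assms by (intro sum.cong) (auto simp: diagonal_mat_def)
  finally show ?thesis
    using assms by simp
qed

lemma skew_symmetrizable_sgn:
  assumes "skew_symmetrizable A" "A \<in> carrier_mat n n" "i < n" "j < n"
  shows "sgn (A $$ (i,j)) = - sgn (A $$ (j,i))"
proof -
  let ?R = "map_mat real_of_int A"
  obtain D where D: "D \<in> carrier_mat n n" "diagonal_mat D"
    and pos: "D $$ (i,i) > 0" "D $$ (j,j) > 0"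
    and skew: "transpose_mat (D * ?R) = - (D * ?R)"
    using assms
    by (auto simp: skew_symmetrizable_def positive_diagonal_def skew_symmetric_def)
  have R: "?R \<in> carrier_mat n n"
    using assms by simp
  have "(D * ?R) $$ (j,i) = transpose_mat (D * ?R) $$ (i,j)"
    using assms D by simp
  also have "\<dots> = - (D * ?R) $$ (i,j)"
    unfolding skew using assms D by simp
  finally have "D $$ (j,j) * real_of_int (A $$ (j,i)) = - (D $$ (i,i) * real_of_int (A $$ (i,j)))"
    using assms by (simp only: diagonal_mult_entry[OF D R]) simp
  then have "sgn (D $$ (j,j) * real_of_int (A $$ (j,i)))
      = - sgn (D $$ (i,i) * real_of_int (A $$ (i,j)))"
    by (simp only: sgn_minus)
  with pos have "sgn (real_of_int (A $$ (j,i))) = - sgn (real_of_int (A $$ (i,j)))"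
    by (simp add: sgn_mult)
  then show ?thesis
    by (simp add: sgn_if split: if_splits)
qed

section \<open>Rows of the principal matrix\<close>

lemma monomial_poly_add_eq_iff:
  "monomial_poly a + monomial_poly b = monomial_poly c + monomial_poly d
    \<longleftrightarrow> a = c \<and> b = d \<or> a = d \<and> b = c"
proof
  assume eq: "monomial_poly a + monomial_poly b = monomial_poly c + monomial_poly d"
  have coeff: "(if k = a then 1 else 0) + (if k = b then 1 else 0)
      = (if k = c then 1 else 0) + (if k = d then 1 else (0::int))" for k
    using arg_cong[OF eq, of "\<lambda>p. Poly_Mapping.lookup p k"]
    by (simp add: monomial_poly_def lookup_add lookup_single when_def eq_commute)
  show "a = c \<and> b = d \<or> a = d \<and> b = c"
    using coeff[of a] coeff[of b] coeff[of c] by (auto split: if_splits)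
qed (auto simp: add.commute)

text \<open>The list \<open>r\<close> is row \<open>i\<close> of the principal matrix of \<open>S\<close> for one of the two orderings of the
  monomials of the \<open>i\<close>-th exchange polynomial. Positions in the list, like matrix indices,
  start at 0 and follow the order of the list of mutable variables.\<close>

definition exponent_row :: "'v seed \<Rightarrow> nat \<Rightarrow> int list \<Rightarrow> bool" where
  "exponent_row S i r \<longleftrightarrow> (\<exists>P M.
     exchange_polys S ! i = monomial_poly P + monomial_poly M \<and>
     r = map (\<lambda>v. int (Poly_Mapping.lookup P v) - int (Poly_Mapping.lookup M v))
       (mutable_vars S))"

lemma exponent_rowI:
  assumes "exchange_polys S ! i = monomial_poly P + monomial_poly M"
    and "map (\<lambda>v. int (Poly_Mapping.lookup P v) - int (Poly_Mapping.lookup M v))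
      (mutable_vars S) = r"
  shows "exponent_row S i r"
  using assms unfolding exponent_row_def by blast

lemma principal_matrix_row:
  assumes "principal_matrix S B" "exponent_row S i r" "i < length (mutable_vars S)"
  shows "\<exists>s\<in>{1,-1}. \<forall>j<length (mutable_vars S). B $$ (i,j) = s * r ! j"
proof -
  obtain P M where PM: "exchange_polys S ! i = monomial_poly P + monomial_poly M"
    and r: "r = map (\<lambda>v. int (Poly_Mapping.lookup P v) - int (Poly_Mapping.lookup M v))
      (mutable_vars S)"
    using assms(2) unfolding exponent_row_def by blast
  obtain P' M' where PM': "exchange_polys S ! i = monomial_poly P' + monomial_poly M'"
    and B: "\<forall>j<length (mutable_vars S). B $$ (i,j) =
      int (Poly_Mapping.lookup P' (mutable_vars S ! j))
      - int (Poly_Mapping.lookup M' (mutable_vars S ! j))"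
    using assms(1,3) unfolding principal_matrix_def Let_def by blast
  from PM PM' consider "P' = P" "M' = M" | "P' = M" "M' = P"
    by (auto simp: monomial_poly_add_eq_iff)
  then show ?thesis
  proof cases
    case 1
    with B r show ?thesis by (intro bexI[of _ 1]) auto
  next
    case 2
    with B r show ?thesis by (intro bexI[of _ "-1"]) auto
  qed
qed

text \<open>The family \<open>s\<close> below combines the row signs of \<open>D\<close> with those left open by the principal
  matrix. It does not depend on the pair of rows considered, which is what makes the conditions
  along a cycle interact.\<close>

lemma skew_symmetrizable_row_signs:
  assumes B: "principal_matrix S B" and D: "sign_diagonal (length (mutable_vars S)) D"
    and skew: "skew_symmetrizable (D * B)"
    and row: "\<And>i. i \<in> I \<Longrightarrow> exponent_row S i (r i)"
    and I: "I \<subseteq> {..<length (mutable_vars S)}"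
  obtains s where "\<And>i. i \<in> I \<Longrightarrow> s i = 1 \<or> s i = -1"
    and "\<And>i j. i \<in> I \<Longrightarrow> j \<in> I \<Longrightarrow> s i * sgn (r i ! j) = - (s j * sgn (r j ! i))"
proof -
  let ?n = "length (mutable_vars S)"
  have Dn: "D \<in> carrier_mat ?n ?n" "diagonal_mat D"
    and Ds: "\<And>i. i < ?n \<Longrightarrow> D $$ (i,i) = 1 \<or> D $$ (i,i) = -1"
    using D by (auto simp: sign_diagonal_def)
  have Bn: "B \<in> carrier_mat ?n ?n"
    using B by (simp add: principal_matrix_def Let_def)
  have "\<forall>i\<in>I. \<exists>t\<in>{1,-1}. \<forall>j<?n. B $$ (i,j) = t * r i ! j"
    using principal_matrix_row[OF B row] I by blast
  then obtain t where t: "\<And>i. i \<in> I \<Longrightarrow> t i = 1 \<or> t i = -1"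
    and Bt: "\<And>i j. i \<in> I \<Longrightarrow> j < ?n \<Longrightarrow> B $$ (i,j) = t i * r i ! j"
    by (metis insert_iff singletonD)
  define s where "s i = D $$ (i,i) * t i" for i
  have s: "s i = 1 \<or> s i = -1" if "i \<in> I" for i
    using t[OF that] Ds[of i] I that unfolding s_def by auto
  have entry: "sgn ((D * B) $$ (i,j)) = s i * sgn (r i ! j)" if "i \<in> I" "j \<in> I" for i j
  proof -
    have ij: "i < ?n" "j < ?n" using that I by auto
    have "(D * B) $$ (i,j) = s i * r i ! j"
      using diagonal_mult_entry[OF Dn Bn ij] ij Bt[OF \<open>i \<in> I\<close> ij(2)]
      by (simp add: s_def)
    then show ?thesis
      using s[OF \<open>i \<in> I\<close>] by (auto simp: sgn_mult)
  qed
  have "s i * sgn (r i ! j) = - (s j * sgn (r j ! i))" if "i \<in> I" "j \<in> I" for i j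
  proof -
    have "i < ?n" "j < ?n" using that I by auto
    with skew_symmetrizable_sgn[OF skew mult_carrier_mat[OF Dn(1) Bn]]
    have "sgn ((D * B) $$ (i,j)) = - sgn ((D * B) $$ (j,i))" .
    then show ?thesis
      by (simp only: entry that)
  qed
  with s show ?thesis by (rule that)
qed

section \<open>The three seeds\<close>

lemmas exponent_row_simps = variable_def monomial_poly_mult power2_eq_square lookup_add
  lookup_single

lemma not_skew_symmetrizable_D4_G2:
  assumes "principal_matrix seed_D4_G2 B" "sign_diagonal (length (mutable_vars seed_D4_G2)) D"
  shows "\<not> skew_symmetrizable (D * B)"
proof
  assume skew: "skew_symmetrizable (D * B)"
  define r :: "nat \<Rightarrow> int list"
    where "r = (!) [[0, 0, 0, 1], [1, 0, 0, -2]]"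
  have "exponent_row seed_D4_G2 0 (r 0)" "exponent_row seed_D4_G2 1 (r 1)"
    by ((rule exponent_rowI, simp add: seed_D4_G2_def exponent_row_simps,
      simp add: seed_D4_G2_def exponent_row_simps r_def)+)
  then have row: "exponent_row seed_D4_G2 i (r i)" if "i \<in> {0, 1}" for i
    using that by blast
  have "{0, 1} \<subseteq> {..<length (mutable_vars seed_D4_G2)}"
    by (simp add: seed_D4_G2_def)
  then obtain s where s: "\<And>i. i \<in> {0, 1} \<Longrightarrow> s i = 1 \<or> s i = -1"
    and sgn: "\<And>i j. i \<in> {0, 1} \<Longrightarrow> j \<in> {0, 1} \<Longrightarrow>
      s i * sgn (r i ! j) = - (s j * sgn (r j ! i))"
    using skew_symmetrizable_row_signs[OF assms skew row] by blast
  have "s 1 = 0"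
    using sgn[of 0 1] by (simp add: r_def)
  then show False
    using s[of 1] by simp
qed

lemma not_skew_symmetrizable_F4_B4:
  assumes "principal_matrix seed_F4_B4 B" "sign_diagonal (length (mutable_vars seed_F4_B4)) D"
  shows "\<not> skew_symmetrizable (D * B)"
proof
  assume skew: "skew_symmetrizable (D * B)"
  define r :: "nat \<Rightarrow> int list"
    where "r = (!) [[0, 1, 0, -1], [1, 0, 1, -1], [0, 1, 0, 0], [0, 1, 0, 0]]"
  have "exponent_row seed_F4_B4 0 (r 0)" "exponent_row seed_F4_B4 3 (r 3)"
    by ((rule exponent_rowI, simp add: seed_F4_B4_def exponent_row_simps,
      simp add: seed_F4_B4_def exponent_row_simps r_def)+)
  then have row: "exponent_row seed_F4_B4 i (r i)" if "i \<in> {0, 3}" for i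
    using that by blast
  have "{0, 3} \<subseteq> {..<length (mutable_vars seed_F4_B4)}"
    by (simp add: seed_F4_B4_def)
  then obtain s where s: "\<And>i. i \<in> {0, 3} \<Longrightarrow> s i = 1 \<or> s i = -1"
    and sgn: "\<And>i j. i \<in> {0, 3} \<Longrightarrow> j \<in> {0, 3} \<Longrightarrow>
      s i * sgn (r i ! j) = - (s j * sgn (r j ! i))"
    using skew_symmetrizable_row_signs[OF assms skew row] by blast
  have "s 0 = 0"
    using sgn[of 0 3] by (simp add: r_def)
  then show False
    using s[of 0] by simp
qed

lemma not_skew_symmetrizable_E6_F4:
  assumes "principal_matrix seed_E6_F4 B" "sign_diagonal (length (mutable_vars seed_E6_F4)) D"
  shows "\<not> skew_symmetrizable (D * B)"
proof
  assume skew: "skew_symmetrizable (D * B)"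
  \<comment> \<open>Columns and rows are indexed by the variables with numbers 12, 4, 9, 21, 22, 23, 24, 25,
    in this order, so the cycle runs through the positions 3, 4, 5, 7, 6.\<close>
  define r :: "nat \<Rightarrow> int list" where "r = (!)
   [[ 0, 1,-1,-1, 0, 0, 1, 0],
    [-1, 0, 0, 1, 0, 0, 0, 0],
    [ 1, 0, 0, 0, 0, 0,-1, 0],
    [ 1,-1, 0, 0,-1, 0,-1, 0],
    [ 0, 0, 0, 1, 0,-1, 0, 0],
    [ 0, 0, 0, 0, 1, 0, 0, 1],
    [-1, 0, 1, 1, 0, 0, 0, 1],
    [ 0, 0, 0, 0, 0,-1, 1, 0]]"
  let ?I = "{3, 4, 5, 6, 7} :: nat set"
  have "exponent_row seed_E6_F4 3 (r 3)" "exponent_row seed_E6_F4 4 (r 4)"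
    "exponent_row seed_E6_F4 5 (r 5)" "exponent_row seed_E6_F4 6 (r 6)"
    "exponent_row seed_E6_F4 7 (r 7)"
    by ((rule exponent_rowI, simp add: seed_E6_F4_def exponent_row_simps,
      simp add: seed_E6_F4_def exponent_row_simps r_def)+)
  then have row: "exponent_row seed_E6_F4 i (r i)" if "i \<in> ?I" for i
    using that by blast
  have "?I \<subseteq> {..<length (mutable_vars seed_E6_F4)}"
    by (simp add: seed_E6_F4_def)
  then obtain s where s: "\<And>i. i \<in> ?I \<Longrightarrow> s i = 1 \<or> s i = -1"
    and sgn: "\<And>i j. i \<in> ?I \<Longrightarrow> j \<in> ?I \<Longrightarrow> s i * sgn (r i ! j) = - (s j * sgn (r j ! i))"
    using skew_symmetrizable_row_signs[OF assms skew row] by blast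
  have "s 3 = s 4" "s 4 = s 5" "s 5 = s 7" "s 7 = - s 6" "s 6 = s 3"
    using sgn[of 3 4] sgn[of 4 5] sgn[of 5 7] sgn[of 7 6] sgn[of 6 3] by (simp_all add: r_def)
  then show False
    using s[of 3] by auto
qed

theorem corollary7p8:
  fixes S :: "var seed" and B\<^sub>0 D\<^sub>\<epsilon> :: "int mat"
  assumes "S \<in> {seed_D4_G2, seed_E6_F4, seed_F4_B4}"
    and "principal_matrix S B\<^sub>0"
    and "sign_diagonal (length (mutable_vars S)) D\<^sub>\<epsilon>"
  shows "\<not> skew_symmetrizable (D\<^sub>\<epsilon> * B\<^sub>0)"
  using assms not_skew_symmetrizable_D4_G2 not_skew_symmetrizable_E6_F4
    not_skew_symmetrizable_F4_B4
  by blast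

end
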